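(* Let $N, K \in \mathbb{N}$, $b > 0$, $\epsilon > 0$, $\Delta t > 0$. Let $\{w_k^i : 1 \leq i \leq N,\ 1 \leq k \leq K\}$ be mutually independent random variables, each with distribution $\mathrm{Lap}(b/\epsilon)$, and for each customer $i \in \{1,\dots,N\}$ let $\tilde{E}^i_{\mathcal{K}} = \Delta t \sum_{k=1}^K w_k^i$ be the error in the estimated energy consumption of customer $i$. Assuming the Gaussian approximation of $\tilde{E}^i_{\mathcal{K}}$ holds, the mean of the maximum of $\tilde{E}^i_{\mathcal{K}}$ among the $N$ customers satisfies $$0.478\,\frac{b}{\epsilon}\,\Delta t\,\sqrt{K}\,\sqrt{\log N} \;\leq\; \mathbb{E}\left[\max_{1 \leq i \leq N} \tilde{E}^i_{\mathcal{K}}\right] \;\leq\; 2\,\frac{b}{\epsilon}\,\Delta t\,\sqrt{K}\,\sqrt{\log N},$$ and the variance of the maximum satisfies $$\mathrm{var}\left[\max_{1 \leq i \leq N} \tilde{E}^i_{\mathcal{K}}\right] \leq 8K\,\frac{b^2}{\epsilon^2}\,(\Delta t)^2.$$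
   Context: $\mathrm{Lap}(c)$ is the Laplace distribution with mean $0$ and scale $c$ (density $\frac{1}{2c}e^{-|x|/c}$, variance $2c^2$); $\log$ is the natural logarithm. Setting: customer $i$ has true power demand $d^i_k$ at sampling instant $k \in \mathcal{K} = \{1,\dots,K\}$, with sampling period $\Delta t$; the utility only sees the private demand $\hat d^i_k = d^i_k + w^i_k$. The true energy is $E^i_{\mathcal{K}} = \sum_{k} d^i_k \Delta t$, the private energy is $\hat{E}^i_{\mathcal{K}} = \sum_k \hat d^i_k \Delta t$, and $\tilde E^i_{\mathcal{K}} = \hat E^i_{\mathcal{K}} - E^i_{\mathcal{K}} = \Delta t\sum_k w^i_k$. "The Gaussian approximation of $\tilde{E}^i_{\mathcal{K}}$ holds" means that, in the conclusions, $\tilde E^1_{\mathcal{K}},\dots,\tilde E^N_{\mathcal{K}}$ are treated as i.i.d. Gaussian random variables with the mean and variance of $\Delta t\sum_k w_k^i$, namely mean $0$ and variance $2K\frac{b^2}{\epsilon^2}(\Delta t)^2$. *)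

theory Defs
  imports "HOL-Probability.Probability"
begin

definition laplace_density :: "real \<Rightarrow> real \<Rightarrow> real" where
  "laplace_density c x = exp (- \<bar>x\<bar> / c) / (2 * c)"

definition energy_error :: "real \<Rightarrow> nat \<Rightarrow> (nat \<Rightarrow> nat \<Rightarrow> 'a \<Rightarrow> real) \<Rightarrow> nat \<Rightarrow> 'a \<Rightarrow> real" where
  "energy_error \<Delta>t K w i = (\<lambda>x. \<Delta>t * (\<Sum>k=1..K. w i k x))"

text \<open>
  A finite sum of independent Laplace variables is never exactly Gaussian, so assuming that the
  errors themselves are Gaussian would be contradictory. Instead, the family \<open>E\<close> on \<open>M\<close> is replaced
  by independent Gaussian variables \<open>G\<close>, living on an arbitrary probability space \<open>M'\<close>, each with
  the same mean and variance as the variable it stands for. The second parameter of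
  \<^const>\<open>normal_density\<close> is the standard deviation.
\<close>

definition gaussian_approximation ::
  "'a measure \<Rightarrow> ('i \<Rightarrow> 'a \<Rightarrow> real) \<Rightarrow> 'b measure \<Rightarrow> ('i \<Rightarrow> 'b \<Rightarrow> real) \<Rightarrow> 'i set \<Rightarrow> bool" where
  "gaussian_approximation M E M' G I \<longleftrightarrow>
     prob_space M' \<and>
     prob_space.indep_vars M' (\<lambda>_. borel) G I \<and>
     (\<forall>i\<in>I. distributed M' lborel (G i)
        (normal_density (prob_space.expectation M (E i)) (sqrt (prob_space.variance M (E i)))))"

end

theory Submission
  imports Defs "HOL-Real_Asymp.Real_Asymp"
begin

text \<open>
  Each energy error has mean \<open>0\<close> and variance \<open>\<sigma>\<^sup>2 = 2 K (b/\<epsilon>)\<^sup>2 \<Delta>t\<^sup>2\<close>, so the claim concerns the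
  maximum \<open>Y\<close> of \<open>N\<close> independent centred Gaussians of standard deviation \<open>\<sigma>\<close>. By scaling it suffices
  to bound \<open>Y\<close> for \<open>\<sigma> = 1\<close>, and there the claim becomes
  \<open>(0.478/\<surd>2) \<surd>(ln N) \<le> E Y \<le> \<surd>(2 ln N)\<close> and \<open>Var Y \<le> 4\<close>. Below, \<open>\<phi>\<close> and \<open>\<Phi>\<close> are the standard normal
  density and distribution function.

  Upper bound (\<open>expectation_Max_std_normal_le\<close>). The exponential moment of a maximum is at most the
  sum of the exponential moments, \<open>E exp(tY) \<le> N exp(t\<^sup>2/2)\<close>; take logarithms and \<open>t = \<surd>(2 ln N)\<close>.

  Lower bound (\<open>expectation_Max_std_normal_ge\<close>). One variable \<open>X\<^sub>j\<close> is singled out, and whenever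
  one of the others reaches a level \<open>a\<close> it lifts the maximum to at least \<open>max X\<^sub>j a\<close>. Since \<open>X\<^sub>j\<close> has
  mean \<open>0\<close> and is independent of the others, this gives \<open>E Y \<ge> a (1 - \<Phi>(a)^(N-1))\<close>
  (\<open>expectation_Max_centered_indep_ge\<close>). The level \<open>a = \<surd>(ln N) / 2\<close> is reached with probability at
  least \<open>0.7\<close> once \<open>N \<ge> 8\<close>, because the tail of \<open>\<phi>\<close> beyond \<open>a\<close> is of order at least \<open>N powr (-1/4)\<close>. For
  \<open>2 \<le> N \<le> 8\<close> the expected maximum of two of the variables, \<open>1 / \<surd>\<pi>\<close>, is already large enough.

  Variance (\<open>variance_Max_std_normal_le_1\<close>). The density \<open>N \<phi> \<Phi>^(N-1)\<close> of \<open>Y\<close> is the Gaussian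
  density times a log-concave factor, and such a factor can only decrease the variance (the
  one-dimensional Brascamp-Lieb inequality for the identity function). The proof is one
  integration by parts: with \<open>k = (N-1) \<phi>/\<Phi>\<close> the logarithmic derivative of the factor and \<open>m = E Y\<close>,
  it gives \<open>Var Y = 1 + E((Y - m) k(Y))\<close>, and the last term is nonpositive because \<open>k\<close> decreases.
  Hence \<open>Var Y \<le> 1\<close>.
\<close>

section \<open>Mean and variance of the Laplace energy error\<close>

text \<open>
  On the positive half-line the Laplace density is half the exponential density of rate \<open>1/c\<close>.
\<close>
lemma has_bochner_integral_laplace_half_moment:
  assumes c: "c > 0"
  shows "has_bochner_integral lborel (\<lambda>x. indicator {0..} x *\<^sub>R (laplace_density c x * x ^ i)) (fact i * c ^ i / 2)"
proof -
  have "has_bochner_integral lborel (\<lambda>x. exponential_density (1/c) x * x ^ i) (fact i * c ^ i)"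
  proof (rule has_bochner_integral_nn_integral)
    show "(\<integral>\<^sup>+ x. ennreal (exponential_density (1/c) x * x ^ i) \<partial>lborel) = ennreal (fact i * c ^ i)"
      using nn_integral_erlang_ith_moment[of "1/c" 0 i] c by (simp add: power_one_over)
  qed (use c in \<open>auto simp: exponential_density_def\<close>)
  from has_bochner_integral_divide_zero[OF this, of 2]
  show ?thesis
    by (rule has_bochner_integral_cong[THEN iffD1, rotated -1])
       (use c in \<open>auto simp: exponential_density_def laplace_density_def indicator_def\<close>)
qed

lemma
  assumes c: "c > 0"
  shows laplace_first_moment: "has_bochner_integral lborel (\<lambda>x. laplace_density c x * x) 0"
    and laplace_second_moment: "has_bochner_integral lborel (\<lambda>x. laplace_density c x * x\<^sup>2) (2 * c\<^sup>2)"
proof -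
  show "has_bochner_integral lborel (\<lambda>x. laplace_density c x * x) 0"
    using has_bochner_integral_odd_function[OF has_bochner_integral_laplace_half_moment[OF c, of 1]]
    by (simp add: laplace_density_def)
  show "has_bochner_integral lborel (\<lambda>x. laplace_density c x * x\<^sup>2) (2 * c\<^sup>2)"
    using has_bochner_integral_even_function[OF has_bochner_integral_laplace_half_moment[OF c, of 2]]
    by (simp add: laplace_density_def fact_numeral)
qed

lemma (in prob_space)
  assumes c: "c > 0" and D: "distributed M lborel X (laplace_density c)"
  shows laplace_integrable: "integrable M X"
    and laplace_square_integrable: "integrable M (\<lambda>x. (X x)\<^sup>2)"
    and laplace_expectation: "expectation X = 0"
    and laplace_expectation_square: "expectation (\<lambda>x. (X x)\<^sup>2) = 2 * c\<^sup>2"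
proof -
  have nn: "laplace_density c x \<ge> 0" for x
    using c by (simp add: laplace_density_def)
  note i = distributed_integrable[OF D _ nn] and e = distributed_integral[OF D _ nn]
  show "integrable M X" "integrable M (\<lambda>x. (X x)\<^sup>2)"
    "expectation X = 0" "expectation (\<lambda>x. (X x)\<^sup>2) = 2 * c\<^sup>2"
    using i[of "\<lambda>x. x"] i[of "\<lambda>x. x\<^sup>2"] e[of "\<lambda>x. x"] e[of "\<lambda>x. x\<^sup>2"]
      laplace_first_moment[OF c] laplace_second_moment[OF c]
    by (auto simp: has_bochner_integral_iff)
qed

text \<open>
  Independence makes the mixed terms vanish, so variances add.
\<close>
lemma (in prob_space) square_sum_indep_centered:
  fixes X :: "'i \<Rightarrow> 'a \<Rightarrow> real"
  assumes "finite I" and "indep_vars (\<lambda>_. borel) X I"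
    and "\<And>i. i \<in> I \<Longrightarrow> integrable M (X i)"
    and "\<And>i. i \<in> I \<Longrightarrow> integrable M (\<lambda>x. (X i x)\<^sup>2)"
    and "\<And>i. i \<in> I \<Longrightarrow> expectation (X i) = 0"
  shows "has_bochner_integral M (\<lambda>x. (\<Sum>i\<in>I. X i x)\<^sup>2) (\<Sum>i\<in>I. expectation (\<lambda>x. (X i x)\<^sup>2))"
  using assms
proof (induction I rule: finite_induct)
  case (insert j I)
  let ?S = "\<lambda>x. \<Sum>i\<in>I. X i x"
  have IH: "has_bochner_integral M (\<lambda>x. (?S x)\<^sup>2) (\<Sum>i\<in>I. expectation (\<lambda>x. (X i x)\<^sup>2))"
    using insert by (intro insert.IH) (auto intro: indep_vars_subset)
  have ind: "indep_var borel (X j) borel ?S"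
    using insert by (intro indep_vars_sum) auto
  have S: "integrable M ?S"
    using insert by auto
  have "has_bochner_integral M (\<lambda>x. X j x * ?S x) 0"
    using indep_var_lebesgue_integral[OF ind _ S] indep_var_integrable[OF ind _ S] insert.prems
    by (simp add: has_bochner_integral_iff)
  from has_bochner_integral_mult_right[OF this, of 2]
  have 1: "has_bochner_integral M (\<lambda>x. 2 * (X j x * ?S x)) 0" by simp
  have 2: "has_bochner_integral M (\<lambda>x. (X j x)\<^sup>2) (expectation (\<lambda>x. (X j x)\<^sup>2))"
    using insert.prems by (simp add: has_bochner_integral_iff)
  from has_bochner_integral_add[OF has_bochner_integral_add[OF 2 1] IH] insert.hyps
  show ?case by (simp add: power2_sum ac_simps)
qed (simp add: has_bochner_integral_zero)

lemma (in prob_space)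
  assumes c: "c > 0"
    and ind: "indep_vars (\<lambda>_. borel) (\<lambda>(i, k). w i k) (A \<times> {1..K})" and i: "i \<in> A"
    and D: "\<And>k. k \<in> {1..K} \<Longrightarrow> distributed M lborel (w i k) (laplace_density c)"
  shows expectation_energy_error: "expectation (energy_error \<Delta>t K w i) = 0"
    and variance_energy_error: "variance (energy_error \<Delta>t K w i) = 2 * real K * c\<^sup>2 * \<Delta>t\<^sup>2"
proof -
  note l = laplace_integrable[OF c D] laplace_square_integrable[OF c D] laplace_expectation[OF c D]
    laplace_expectation_square[OF c D]
  show E: "expectation (energy_error \<Delta>t K w i) = 0"
    unfolding energy_error_def using l by (simp add: Bochner_Integration.integral_sum)
  (* The row i of the array, kept as a set of pairs so that independence restricts to it. *)
  let ?J = "Pair i ` {1..K}"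
  have "has_bochner_integral M (\<lambda>x. (\<Sum>p\<in>?J. (case p of (i, k) \<Rightarrow> w i k) x)\<^sup>2)
      (\<Sum>p\<in>?J. expectation (\<lambda>x. ((case p of (i, k) \<Rightarrow> w i k) x)\<^sup>2))"
  proof (rule square_sum_indep_centered)
    show "indep_vars (\<lambda>_. borel) (\<lambda>(i, k). w i k) ?J"
      by (rule indep_vars_subset[OF ind]) (use i in auto)
  qed (use l in auto)
  then have "has_bochner_integral M (\<lambda>x. (\<Sum>k=1..K. w i k x)\<^sup>2) (\<Sum>k=1..K. expectation (\<lambda>x. (w i k x)\<^sup>2))"
    by (simp add: sum.reindex inj_on_def)
  then show "variance (energy_error \<Delta>t K w i) = 2 * real K * c\<^sup>2 * \<Delta>t\<^sup>2"
    unfolding E using l by (simp add: energy_error_def power_mult_distrib has_bochner_integral_iff)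
qed

section \<open>The standard normal distribution function\<close>

abbreviation std_normal_cdf :: "real \<Rightarrow> real" where
  "std_normal_cdf \<equiv> cdf std_normal_distribution"

lemma measure_std_normal:
  assumes [measurable]: "A \<in> sets borel"
  shows "measure std_normal_distribution A = (\<integral>x. indicator A x * std_normal_density x \<partial>lborel)"
    and "integrable lborel (\<lambda>x. indicator A x * std_normal_density x)"
proof -
  interpret real_distribution "std_normal_distribution"
    by (rule real_dist_normal_dist)
  show "integrable lborel (\<lambda>x. indicator A x * std_normal_density x)"
    using integrable_mult_indicator[of A lborel std_normal_density] by simp
  have "measure std_normal_distribution A = (\<integral>x. indicator A x \<partial>std_normal_distribution)"
    by simp
  also have "\<dots> = (\<integral>x. std_normal_density x * indicator A x \<partial>lborel)"
    by (rule integral_real_density) auto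
  finally show "measure std_normal_distribution A = (\<integral>x. indicator A x * std_normal_density x \<partial>lborel)"
    by (simp add: ac_simps)
qed

lemma continuous_std_normal_density: "continuous_on A std_normal_density"
  unfolding std_normal_density_def by (intro continuous_intros) auto

lemma DERIV_std_normal_density:
  "(std_normal_density has_real_derivative - x * std_normal_density x) (at x)"
  unfolding std_normal_density_def by (rule derivative_eq_intros refl | simp)+

lemma DERIV_std_normal_cdf: "(std_normal_cdf has_real_derivative std_normal_density x) (at x)"
proof -
  interpret real_distribution "std_normal_distribution"
    by (rule real_dist_normal_dist)
  \<comment> \<open>On \<open>y > x - 1\<close> the distribution function agrees with this integral over a compact interval.\<close>
  define g where "g y = std_normal_cdf (x - 1) + integral {x-1..y} std_normal_density" for y
  have "(g has_real_derivative std_normal_density x) (at x within {x-1..x+1})"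
    unfolding g_def
    by (auto intro!: derivative_eq_intros integral_has_real_derivative continuous_std_normal_density)
  then have "(g has_real_derivative std_normal_density x) (at x)"
    by (subst (asm) at_within_interior) auto
  moreover have "eventually (\<lambda>y. g y = std_normal_cdf y) (nhds x)"
  proof -
    have "eventually (\<lambda>y. y > x - 1) (nhds x)"
      by (rule eventually_nhds_in_open[of "{x-1<..}", simplified]) auto
    then show ?thesis
    proof eventually_elim
      case (elim y)
      have "std_normal_cdf y - std_normal_cdf (x-1) = measure std_normal_distribution {x-1<..y}"
        using elim by (rule cdf_diff_eq)
      also have "\<dots> = measure std_normal_distribution {x-1..y}"
        by (intro measure_eq_AE) (auto simp: AE_density intro!: AE_I[where N="{x-1}"] simp: )
      also have "\<dots> = set_lebesgue_integral lborel {x-1..y} std_normal_density"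
        by (simp add: measure_std_normal set_lebesgue_integral_def)
      also have "\<dots> = integral {x-1..y} std_normal_density"
        by (intro set_borel_integral_eq_integral)
           (auto simp: set_integrable_def measure_std_normal)
      finally show ?case by (simp add: g_def)
    qed
  qed
  ultimately show ?thesis
    by (subst DERIV_cong_ev[OF refl _ refl, symmetric])
qed

lemma continuous_std_normal_cdf: "continuous_on A std_normal_cdf"
  by (rule DERIV_continuous_on[OF has_field_derivative_at_within[OF DERIV_std_normal_cdf]])

lemma std_normal_cdf_pos: "std_normal_cdf x > 0"
proof -
  interpret real_distribution "std_normal_distribution"
    by (rule real_dist_normal_dist)
  have "std_normal_cdf (x - 1) < std_normal_cdf x"
    by (rule DERIV_pos_imp_increasing[of "x-1" x])
       (auto intro!: exI[of _ "std_normal_density _"] DERIV_std_normal_cdf normal_density_pos)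
  moreover have "std_normal_cdf (x - 1) \<ge> 0" by (rule cdf_nonneg)
  ultimately show ?thesis by linarith
qed

lemma std_normal_cdf_le_1: "std_normal_cdf x \<le> 1"
  using real_distribution.cdf_bounded_prob[OF real_dist_normal_dist] .

text \<open>
  Substituting \<open>t = z - s\<close> in the integral of \<open>\<phi>\<close> gives \<open>\<Phi>(z)/\<phi>(z) = \<integral> exp(zs - s\<^sup>2/2) ds\<close> over \<open>s \<ge> 0\<close>,
  and the integrand increases with \<open>z\<close>. So \<open>\<phi>/\<Phi>\<close>, the derivative of \<open>ln \<Phi>\<close>, decreases: \<open>\<Phi>\<close> is
  log-concave.
\<close>
lemma antimono_inverse_mills_ratio: "antimono (\<lambda>x. std_normal_density x / std_normal_cdf x)"
proof (rule antimonoI)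
  fix x y :: real assume xy: "x \<le> y"
  have cdf: "std_normal_cdf z = (\<integral>s. indicator {0..} s * std_normal_density (z - s) \<partial>lborel)"
    "integrable lborel (\<lambda>s. indicator {0..} s * std_normal_density (z - s))" for z
  proof -
    have *: "indicator {..z} (z + (-1) * s) = (indicator {0..} s :: real)" for s
      by (auto simp: indicator_def)
    show "std_normal_cdf z = (\<integral>s. indicator {0..} s * std_normal_density (z - s) \<partial>lborel)"
      unfolding cdf_def measure_std_normal(1)[OF atMost_borel]
      by (subst lborel_integral_real_affine[where c="-1" and t=z]) (use * in auto)
    show "integrable lborel (\<lambda>s. indicator {0..} s * std_normal_density (z - s))"
      using lborel_integrable_real_affine[OF measure_std_normal(2)[of "{..z}"], of "-1" z] * by simp
  qed
  have "std_normal_density y * std_normal_cdf x = (\<integral>s. std_normal_density y * (indicator {0..} s * std_normal_density (x - s)) \<partial>lborel)"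
    unfolding cdf by simp
  also have "\<dots> \<le> (\<integral>s. std_normal_density x * (indicator {0..} s * std_normal_density (y - s)) \<partial>lborel)"
  proof (intro integral_mono integrable_mult_right cdf)
    fix s :: real
    have "std_normal_density y * std_normal_density (x - s) \<le> std_normal_density x * std_normal_density (y - s)" if "s \<ge> 0"
    proof -
      have "x * s \<le> y * s" using xy that by (intro mult_right_mono)
      then have "- y\<^sup>2 / 2 + - (x - s)\<^sup>2 / 2 \<le> - x\<^sup>2 / 2 + - (y - s)\<^sup>2 / 2"
        by (simp add: power2_eq_square field_simps)
      then have "exp (- y\<^sup>2 / 2) * exp (- (x - s)\<^sup>2 / 2) \<le> exp (- x\<^sup>2 / 2) * exp (- (y - s)\<^sup>2 / 2)"
        by (simp add: exp_add[symmetric])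
      then show ?thesis unfolding std_normal_density_def
        by (auto simp: divide_right_mono)
    qed
    then show "std_normal_density y * (indicator {0..} s * std_normal_density (x - s)) \<le> std_normal_density x * (indicator {0..} s * std_normal_density (y - s))"
      by (auto simp: indicator_def)
  qed
  also have "\<dots> = std_normal_density x * std_normal_cdf y"
    unfolding cdf by simp
  finally show "std_normal_density y / std_normal_cdf y \<le> std_normal_density x / std_normal_cdf x"
    using std_normal_cdf_pos[of x] std_normal_cdf_pos[of y] by (simp add: field_simps)
qed

text \<open>
  From \<open>(a + s)\<^sup>2 \<le> 2 a\<^sup>2 + 2 s\<^sup>2\<close>, the density at \<open>a + s\<close> is at least \<open>exp(-a\<^sup>2) exp(-s\<^sup>2) / \<surd>(2\<pi>)\<close>, and
  the integral of \<open>exp(-s\<^sup>2)\<close> over \<open>s \<ge> 0\<close> is \<open>\<surd>\<pi>/2\<close>. The exponent \<open>a\<^sup>2\<close> is twice the true rate, which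
  the small level chosen later can afford.
\<close>
lemma std_normal_upper_tail_ge:
  "exp (- a\<^sup>2) / (2 * sqrt 2) \<le> 1 - std_normal_cdf a"
proof -
  interpret N: real_distribution std_normal_distribution
    by (rule real_dist_normal_dist)
  have *: "indicator {a..} (a + s) = (indicator {0..} s :: real)" for s :: real
    by (auto simp: indicator_def)
  have g: "(\<integral>s. indicator {0..} s * exp (- s\<^sup>2) \<partial>lborel) = sqrt pi / 2"
    "integrable lborel (\<lambda>s. indicator {0..} s * exp (- s\<^sup>2 :: real))"
    using gaussian_moment_0 by (simp_all add: has_bochner_integral_iff)
  have "exp (- a\<^sup>2) / (2 * sqrt 2) = exp (- a\<^sup>2) / sqrt (2 * pi) * (sqrt pi / 2)"
    by (simp add: real_sqrt_mult field_simps)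
  also have "\<dots> = (\<integral>s. exp (- a\<^sup>2) / sqrt (2 * pi) * (indicator {0..} s * exp (- s\<^sup>2)) \<partial>lborel)"
    by (simp add: g(1))
  also have "\<dots> \<le> (\<integral>s. indicator {a..} (a + s) * std_normal_density (a + s) \<partial>lborel)"
  proof (rule integral_mono)
    show "integrable lborel (\<lambda>s. exp (- a\<^sup>2) / sqrt (2 * pi) * (indicator {0..} s * exp (- s\<^sup>2)))"
      using g by simp
    show "integrable lborel (\<lambda>s. indicator {a..} (a + s) * std_normal_density (a + s))"
      using lborel_integrable_real_affine[OF measure_std_normal(2)[of "{a..}"], of 1 a] by simp
    fix s
    have "0 \<le> (a - s)\<^sup>2" by simp
    then have "- a\<^sup>2 + - s\<^sup>2 \<le> - (a + s)\<^sup>2 / 2" by (simp add: power2_eq_square algebra_simps)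
    then have "exp (- a\<^sup>2) * exp (- s\<^sup>2) \<le> exp (- (a + s)\<^sup>2 / 2)"
      unfolding exp_add[symmetric] by simp
    then show "exp (- a\<^sup>2) / sqrt (2 * pi) * (indicator {0..} s * exp (- s\<^sup>2)) \<le> indicator {a..} (a + s) * std_normal_density (a + s)"
      by (auto simp: indicator_def std_normal_density_def divide_right_mono)
  qed
  also have "\<dots> = measure std_normal_distribution {a..}"
    using lborel_integral_real_affine[of 1 "\<lambda>x. indicator {a..} x * std_normal_density x" a]
    by (simp add: measure_std_normal(1))
  also have "\<dots> = measure std_normal_distribution (UNIV - {..a})"
    by (intro measure_eq_AE) (auto simp: AE_density intro!: AE_I[where N="{a}"])
  also have "\<dots> = 1 - std_normal_cdf a"
    using N.prob_compl[of "{..a}"] by (simp add: cdf_def)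
  finally show ?thesis .
qed

lemma (in prob_space) std_normal_integrable:
  assumes D: "distributed M lborel X std_normal_density"
  shows "integrable M X"
  using distributed_integrable[OF D, of "\<lambda>x. x"] integrable_std_normal_moment[of 1] by simp

lemma (in prob_space) std_normal_prob_le:
  assumes D: "distributed M lborel X std_normal_density"
  shows "\<P>(x in M. X x \<le> a) = std_normal_cdf a"
    and "\<P>(x in M. X x < a) = std_normal_cdf a"
proof -
  have [measurable]: "X \<in> borel_measurable M"
    using distributed_measurable[OF D] by simp
  have distr: "distr M lborel X = std_normal_distribution"
    using distributed_distr_eq_density[OF D] by simp
  show "\<P>(x in M. X x \<le> a) = std_normal_cdf a"
    unfolding cdf_def distr[symmetric]
    by (subst measure_distr) (auto intro!: arg_cong[where f="measure M"])
  have "measure std_normal_distribution {..a} = measure std_normal_distribution {..<a}"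
    by (intro measure_eq_AE) (auto simp: AE_density intro!: AE_I[where N="{a}"])
  then show "\<P>(x in M. X x < a) = std_normal_cdf a"
    unfolding cdf_def distr[symmetric]
    by (auto simp: measure_distr intro!: arg_cong[where f="measure M"])
qed

section \<open>Log-concave factors decrease the Gaussian variance\<close>

text \<open>
  A factor \<open>h\<close> with decreasing logarithmic derivative \<open>k\<close> makes the density \<open>\<phi> h\<close> at least as
  log-concave as \<open>\<phi>\<close> itself. Integrating \<open>((x - m) \<phi> h)'\<close> over the real line yields
  \<open>Var X = 1 + E((X - m) k(X))\<close>, where \<open>m = E X\<close>. As \<open>k\<close> decreases, \<open>(x - m) k(x) \<le> (x - m) k(m)\<close>
  for every \<open>x\<close>, and the right-hand side has expectation \<open>0\<close>. The common bound \<open>B\<close> on \<open>h\<close> and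
  \<open>h' = k h\<close> lets the Gaussian moments dominate every integral and kills the boundary terms.
\<close>
lemma (in prob_space) variance_le_1_of_log_concave_tilt:
  fixes h k :: "real \<Rightarrow> real"
  assumes D: "distributed M lborel X (\<lambda>x. std_normal_density x * h x)"
    and h: "\<And>x. 0 \<le> h x" "\<And>x. h x \<le> B"
    and deriv: "\<And>x. (h has_real_derivative k x * h x) (at x)"
    and bound: "\<And>x. \<bar>k x * h x\<bar> \<le> B"
    and k: "antimono k" "continuous_on UNIV k"
  shows "variance X \<le> 1"
proof -
  let ?\<phi> = std_normal_density
  define m where "m = expectation X"
  have cont_h: "continuous_on UNIV h"
    by (meson DERIV_continuous_on deriv has_field_derivative_at_within)
  have [measurable]: "h \<in> borel_measurable borel" "k \<in> borel_measurable borel"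
    using cont_h k(2) by (auto intro: borel_measurable_continuous_onI)
  have int_poly: "integrable lborel (\<lambda>x. ?\<phi> x * x ^ n * g x)"
    if [measurable]: "g \<in> borel_measurable borel" and "\<And>x. \<bar>g x\<bar> \<le> B" for g :: "real \<Rightarrow> real" and n
  proof (rule Bochner_Integration.integrable_bound)
    show "integrable lborel (\<lambda>x. ?\<phi> x * x ^ n * B)"
      using integrable_std_normal_moment by (rule integrable_mult_left)
    have "B \<ge> 0" using that(2)[of 0] by linarith
    then show "AE x in lborel. norm (?\<phi> x * x ^ n * g x) \<le> norm (?\<phi> x * x ^ n * B)"
      using that(2) by (auto simp: abs_mult intro!: mult_left_mono)
  qed auto
  have hB: "\<bar>h x\<bar> \<le> B" for x using h[of x] by auto
  have nn: "0 \<le> ?\<phi> x * h x" for x using h by simp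
  note i = distributed_integrable[OF D _ nn] and e = distributed_integral[OF D _ nn]
  have I1: "integrable M X" and I2: "integrable M (\<lambda>x. (X x)\<^sup>2)"
    using i[of "\<lambda>x. x"] i[of "\<lambda>x. x\<^sup>2"] int_poly[of h 1] int_poly[of h 2] hB by (auto simp: ac_simps)
  have Ik: "integrable M (\<lambda>x. k (X x))" "integrable M (\<lambda>x. X x * k (X x))"
    using i[of k] i[of "\<lambda>x. x * k x"] int_poly[of "\<lambda>x. k x * h x" 0] int_poly[of "\<lambda>x. k x * h x" 1] bound
    by (auto simp: ac_simps)
  \<comment> \<open>The derivative of \<open>(x - m) \<phi> h\<close> is \<open>\<phi> h q\<close>.\<close>
  define q where "q x = 1 - (x - m) * x + (x - m) * k x" for x
  have [measurable]: "q \<in> borel_measurable borel" unfolding q_def by measurable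
  have Iq: "integrable M (\<lambda>x. q (X x))"
    using I1 I2 Ik by (simp add: q_def algebra_simps power2_eq_square)
  have "(LBINT x=-\<infinity>..\<infinity>. ?\<phi> x * h x * q x) = 0 - 0"
  proof (rule interval_integral_FTC_integrable[where F="\<lambda>x. (x - m) * (?\<phi> x * h x)"])
    fix x
    show "((\<lambda>x. (x - m) * (?\<phi> x * h x)) has_vector_derivative ?\<phi> x * h x * q x) (at x)"
      unfolding has_real_derivative_iff_has_vector_derivative[symmetric]
      by (rule derivative_eq_intros DERIV_std_normal_density deriv refl)+
         (simp add: q_def algebra_simps)
    have "continuous_on UNIV (\<lambda>x. ?\<phi> x * h x * q x)"
      unfolding q_def by (intro continuous_intros continuous_std_normal_density cont_h k)
    then show "isCont (\<lambda>x. ?\<phi> x * h x * q x) x"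
      by (simp add: continuous_on_eq_continuous_at)
  next
    show "set_integrable lborel (einterval (-\<infinity>) \<infinity>) (\<lambda>x. ?\<phi> x * h x * q x)"
      using i[of q] Iq by (simp add: set_integrable_def einterval_def)
  next
    have z: "((\<lambda>x. (x - m) * (?\<phi> x * h x)) \<longlongrightarrow> 0) F" if "((\<lambda>x. (x - m) * ?\<phi> x) \<longlongrightarrow> 0) F" for F
    proof (rule Lim_null_comparison)
      show "\<forall>\<^sub>F x in F. norm ((x - m) * (?\<phi> x * h x)) \<le> \<bar>(x - m) * ?\<phi> x\<bar> * B"
        using hB by (auto simp: abs_mult mult.assoc[symmetric] intro!: mult_left_mono always_eventually)
      show "((\<lambda>x. \<bar>(x - m) * ?\<phi> x\<bar> * B) \<longlongrightarrow> 0) F"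
        using tendsto_mult_left_zero[OF tendsto_rabs_zero[OF that]] .
    qed
    have "((\<lambda>x. (x - m) * ?\<phi> x) \<longlongrightarrow> 0) at_top" "((\<lambda>x. (x - m) * ?\<phi> x) \<longlongrightarrow> 0) at_bot"
      unfolding std_normal_density_def by real_asymp+
    then show "(((\<lambda>x. (x - m) * (?\<phi> x * h x)) \<circ> real_of_ereal) \<longlongrightarrow> 0) (at_right (- \<infinity>))"
      "(((\<lambda>x. (x - m) * (?\<phi> x * h x)) \<circ> real_of_ereal) \<longlongrightarrow> 0) (at_left \<infinity>)"
      unfolding ereal_tendsto_simps by (auto intro: z)
  qed auto
  then have "expectation (\<lambda>x. q (X x)) = 0"
    using e[of q] by (simp add: interval_lebesgue_integral_def set_lebesgue_integral_def einterval_def)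
  also have "expectation (\<lambda>x. q (X x)) = 1 - variance X + expectation (\<lambda>x. (X x - m) * k (X x))"
  proof -
    have "q (X x) = 1 - (X x)\<^sup>2 + m * X x + (X x - m) * k (X x)" for x
      by (simp add: q_def algebra_simps power2_eq_square)
    then have "expectation (\<lambda>x. q (X x)) = 1 - expectation (\<lambda>x. (X x)\<^sup>2) + m * m + expectation (\<lambda>x. (X x - m) * k (X x))"
      using I1 I2 Ik by (simp add: prob_space m_def left_diff_distrib)
    also have "expectation (\<lambda>x. (X x)\<^sup>2) = variance X + m * m"
      using variance_eq[OF I1 I2] by (simp add: m_def power2_eq_square)
    finally show ?thesis by simp
  qed
  finally have V: "variance X = 1 + expectation (\<lambda>x. (X x - m) * k (X x))" by simp
  have "expectation (\<lambda>x. (X x - m) * k (X x)) \<le> expectation (\<lambda>x. (X x - m) * k m)"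
  proof (rule integral_mono)
    fix x
    show "(X x - m) * k (X x) \<le> (X x - m) * k m"
    proof (cases "X x \<le> m")
      case True
      with antimonoD[OF k(1) True] show ?thesis by (intro mult_left_mono_neg) auto
    next
      case False
      with antimonoD[OF k(1), of m "X x"] show ?thesis by (intro mult_left_mono) auto
    qed
  qed (use I1 Ik in \<open>auto simp: left_diff_distrib\<close>)
  also have "\<dots> = 0" using I1 by (simp add: prob_space m_def)
  finally show ?thesis using V by simp
qed

section \<open>Density and variance of the Gaussian maximum\<close>

text \<open>
  By independence the distribution function of the maximum is \<open>\<Phi>^n\<close>; the density is its derivative.
\<close>
lemma (in prob_space) distributed_Max_std_normal:
  fixes X :: "'i \<Rightarrow> 'a \<Rightarrow> real"
  assumes I: "finite I" "I \<noteq> {}" and ind: "indep_vars (\<lambda>_. borel) X I"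
    and D: "\<And>i. i \<in> I \<Longrightarrow> distributed M lborel (X i) std_normal_density"
  shows "distributed M lborel (\<lambda>x. MAX i\<in>I. X i x)
    (\<lambda>x. std_normal_density x * (card I * std_normal_cdf x ^ (card I - 1)))"
proof (rule distributedI_borel_atMost)
  have [measurable]: "X i \<in> borel_measurable M" if "i \<in> I" for i
    using distributed_measurable[OF D[OF that]] by simp
  have [measurable]: "std_normal_cdf \<in> borel_measurable borel"
    by (intro borel_measurable_continuous_onI continuous_std_normal_cdf)
  let ?p = "\<lambda>x. std_normal_density x * (card I * std_normal_cdf x ^ (card I - 1))"
  show "(\<lambda>x. MAX i\<in>I. X i x) \<in> borel_measurable M"
    by (intro borel_measurable_Max I) auto
  show "?p \<in> borel_measurable borel" by measurable
  have nn: "0 \<le> ?p x" for x using std_normal_cdf_pos[of x] by (simp add: less_imp_le)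
  then show "AE x in lborel. 0 \<le> ?p x" by simp
  fix a :: real
  have "{x\<in>space M. (MAX i\<in>I. X i x) \<le> a} = (\<Inter>i\<in>I. X i -` {..a} \<inter> space M)"
    using I by (auto simp: Max_le_iff)
  then have "\<P>(x in M. (MAX i\<in>I. X i x) \<le> a) = (\<Prod>i\<in>I. prob (X i -` {..a} \<inter> space M))"
    using indep_varsD[OF ind I(2,1), of "\<lambda>_. {..a}"] by simp
  also have "\<dots> = (\<Prod>i\<in>I. std_normal_cdf a)"
    by (intro prod.cong refl)
       (auto simp: std_normal_prob_le(1)[OF D, symmetric] intro!: arg_cong[where f="measure M"])
  finally show "emeasure M {x\<in>space M. (MAX i\<in>I. X i x) \<le> a} = ennreal (std_normal_cdf a ^ card I)"
    by (simp add: emeasure_eq_measure)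
  have der: "((\<lambda>x. std_normal_cdf x ^ card I) has_real_derivative ?p x) (at x)" for x
    by (auto intro!: derivative_eq_intros DERIV_std_normal_cdf)
  have cont: "isCont ?p x" for x
    using DERIV_isCont[OF DERIV_std_normal_cdf] DERIV_isCont[OF DERIV_std_normal_density]
    by (intro continuous_intros) auto
  have bot: "((\<lambda>x. std_normal_cdf x ^ card I) \<longlongrightarrow> 0) at_bot"
    using tendsto_power[OF finite_borel_measure.cdf_lim_at_bot[OF real_distribution.finite_borel_measure_M[OF real_dist_normal_dist]], of "card I"] I
    by (simp add: power_0_left card_gt_0_iff[THEN iffD2, THEN neq0_conv[THEN iffD2]])
  have top: "((\<lambda>x. std_normal_cdf x ^ card I) \<longlongrightarrow> std_normal_cdf a ^ card I) (at_left a)"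
    using DERIV_isCont[OF der] by (auto simp: isCont_def intro: tendsto_mono[OF at_le])
  note FTC = interval_integral_FTC_nonneg[where a="-\<infinity>" and b="ereal a"
      and F="\<lambda>x. std_normal_cdf x ^ card I" and f="?p", OF _ der cont _ _ _]
  have si: "set_integrable lborel (einterval (-\<infinity>) a) ?p"
    and "(LBINT x=-\<infinity>..ereal a. ?p x) = std_normal_cdf a ^ card I - 0"
    by (rule FTC; use nn bot top in \<open>auto simp: ereal_tendsto_simps\<close>)+
  then have eq: "(\<integral>x. indicator {..<a} x * ?p x \<partial>lborel) = std_normal_cdf a ^ card I"
    and int: "integrable lborel (\<lambda>x. indicator {..<a} x * ?p x)"
    by (simp_all add: interval_lebesgue_integral_def set_lebesgue_integral_def set_integrable_def einterval_def lessThan_def)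
  have "(\<integral>\<^sup>+ x. ennreal (?p x * indicator {..a} x) \<partial>lborel) = (\<integral>\<^sup>+ x. ennreal (indicator {..<a} x * ?p x) \<partial>lborel)"
    by (intro nn_integral_cong_AE AE_I[where N="{a}"]) (auto simp: indicator_def)
  also have "\<dots> = ennreal (std_normal_cdf a ^ card I)"
    using nn_integral_eq_integral[OF int] eq nn by simp
  finally show "(\<integral>\<^sup>+ x. ennreal (?p x * indicator {..a} x) \<partial>lborel) = ennreal (std_normal_cdf a ^ card I)" .
qed

theorem (in prob_space) variance_Max_std_normal_le_1:
  fixes X :: "'i \<Rightarrow> 'a \<Rightarrow> real"
  assumes I: "finite I" "I \<noteq> {}" and ind: "indep_vars (\<lambda>_. borel) X I"
    and D: "\<And>i. i \<in> I \<Longrightarrow> distributed M lborel (X i) std_normal_density"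
  shows "variance (\<lambda>x. MAX i\<in>I. X i x) \<le> 1"
proof (rule variance_le_1_of_log_concave_tilt[OF distributed_Max_std_normal[OF assms]])
  define n where "n = card I"
  let ?\<Phi> = std_normal_cdf
  let ?k = "\<lambda>x. real (n - 1) * (std_normal_density x / ?\<Phi> x)"
  have \<Phi>: "0 \<le> ?\<Phi> x" "?\<Phi> x \<le> 1" "?\<Phi> x \<noteq> 0" "0 < ?\<Phi> x" for x
    using std_normal_cdf_pos[of x] std_normal_cdf_le_1[of x] by auto
  have n: "n \<ge> 1" using I by (simp add: n_def Suc_leI card_gt_0_iff)
  \<comment> \<open>Cancelling one factor \<open>\<Phi>\<close> shows that this product stays bounded although \<open>\<phi>/\<Phi>\<close> does not.\<close>
  have kh: "?k x * (n * ?\<Phi> x ^ (n - 1)) = real n * real (n - 1) * ?\<Phi> x ^ (n - 2) * std_normal_density x" for x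
  proof (cases "n \<ge> 2")
    case True
    then have "?\<Phi> x ^ (n - 1) = ?\<Phi> x * ?\<Phi> x ^ (n - 2)"
      by (simp add: power_eq_if numeral_2_eq_2)
    then show ?thesis using \<Phi>(3)[of x] by simp
  next
    case False
    with n have "n = 1" by simp
    then show ?thesis by simp
  qed
  show "0 \<le> card I * ?\<Phi> x ^ (card I - 1)" for x using \<Phi> by simp
  have \<phi>: "std_normal_density x \<le> 1" for x
  proof -
    have "1 \<le> sqrt (2 * pi)" using pi_ge_two by (simp add: real_le_rsqrt)
    moreover have "exp (- x\<^sup>2 / 2) \<le> 1" by simp
    ultimately have "exp (- x\<^sup>2 / 2) / sqrt (2 * pi) \<le> 1 / 1" by (intro frac_le) auto
    then show ?thesis by (simp add: std_normal_density_def)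
  qed
  show "card I * ?\<Phi> x ^ (card I - 1) \<le> n * n" for x
  proof -
    have "real n * ?\<Phi> x ^ (n - 1) \<le> real n * n"
      using \<Phi>[of x] n by (intro mult_left_mono order_trans[OF power_le_one]) auto
    then show ?thesis by (simp add: n_def)
  qed
  show "((\<lambda>x. card I * ?\<Phi> x ^ (card I - 1)) has_real_derivative ?k x * (card I * ?\<Phi> x ^ (card I - 1))) (at x)" for x
    unfolding n_def[symmetric] kh
    by (rule derivative_eq_intros DERIV_std_normal_cdf refl)+ (simp add: numeral_2_eq_2)
  show "\<bar>?k x * (card I * ?\<Phi> x ^ (card I - 1))\<bar> \<le> n * n" for x
  proof -
    have "real n * real (n - 1) * ?\<Phi> x ^ (n - 2) * std_normal_density x \<le> real n * real n * 1 * 1"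
      using \<Phi>[of x] \<phi>[of x] by (intro mult_mono power_le_one) auto
    then show ?thesis
      unfolding n_def[symmetric] kh using \<Phi> by (simp add: abs_mult)
  qed
  show "antimono ?k"
    by (intro antimonoI mult_left_mono antimonoD[OF antimono_inverse_mills_ratio]) auto
  show "continuous_on UNIV ?k"
    using \<Phi>(3) by (intro continuous_intros continuous_std_normal_density continuous_std_normal_cdf) auto
qed

section \<open>Upper bound on the expected Gaussian maximum\<close>

lemma (in prob_space) integrable_Max_image:
  fixes X :: "'i \<Rightarrow> 'a \<Rightarrow> real"
  assumes I: "finite I" "I \<noteq> {}" and X: "\<And>i. i \<in> I \<Longrightarrow> integrable M (X i)"
  shows "integrable M (\<lambda>x. MAX i\<in>I. X i x)"
proof (rule Bochner_Integration.integrable_bound)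
  show "integrable M (\<lambda>x. \<Sum>i\<in>I. \<bar>X i x\<bar>)" using X by auto
  show "(\<lambda>x. MAX i\<in>I. X i x) \<in> borel_measurable M"
    using X by (intro borel_measurable_Max I) auto
  show "AE x in M. norm (MAX i\<in>I. X i x) \<le> norm (\<Sum>i\<in>I. \<bar>X i x\<bar>)"
  proof (rule AE_I2)
    fix x
    have "(MAX i\<in>I. X i x) \<in> (\<lambda>i. X i x) ` I" using I by (intro Max_in) auto
    then obtain j where j: "j \<in> I" "(MAX i\<in>I. X i x) = X j x" by auto
    have "\<bar>X j x\<bar> \<le> (\<Sum>i\<in>I. \<bar>X i x\<bar>)"
      by (rule member_le_sum) (use I j in auto)
    then show "norm (MAX i\<in>I. X i x) \<le> norm (\<Sum>i\<in>I. \<bar>X i x\<bar>)" using j by simp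
  qed
qed

text \<open>
  The tangent bound \<open>u \<le> ln A + exp(u)/A - 1\<close> linearises the step from \<open>E exp(tY) \<le> A\<close> to
  \<open>t E Y \<le> ln A\<close>, with \<open>A = n exp(t\<^sup>2/2)\<close>; then \<open>E Y \<le> ln n / t + t/2\<close> is minimised at
  \<open>t = \<surd>(2 ln n)\<close>. This is a union bound.
\<close>
theorem (in prob_space) expectation_Max_std_normal_le:
  fixes X :: "'i \<Rightarrow> 'a \<Rightarrow> real"
  assumes I: "finite I" "I \<noteq> {}"
    and D: "\<And>i. i \<in> I \<Longrightarrow> distributed M lborel (X i) std_normal_density"
  shows "expectation (\<lambda>x. MAX i\<in>I. X i x) \<le> sqrt (2 * ln (card I))"
proof (cases "card I = 1")
  \<comment> \<open>Here the optimal \<open>t\<close> is \<open>0\<close>, by which one cannot divide.\<close>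
  case True
  then obtain i where i: "I = {i}" by (rule card_1_singletonE)
  have "expectation (X i) = 0"
    by (rule standard_normal_distributed_expectation) (use D i in auto)
  then show ?thesis by (simp add: i)
next
  case False
  define n where "n = card I"
  define t where "t = sqrt (2 * ln n)"
  have n: "n \<ge> 2" using I False card_gt_0_iff[of I] by (simp add: n_def)
  have t: "t > 0" using n by (simp add: t_def)
  define A where "A = n * exp (t\<^sup>2 / 2)"
  have A: "A > 0" using n by (simp add: A_def)
  have mgf: "has_bochner_integral M (\<lambda>x. exp (t * X i x)) (exp (t\<^sup>2 / 2))" if "i \<in> I" for i
  proof -
    have eq: "std_normal_density x * exp (t * x) = exp (t\<^sup>2 / 2) * normal_density t 1 x" for x
      unfolding normal_density_def
      by (simp add: exp_add[symmetric] power2_eq_square field_simps)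
    have "has_bochner_integral lborel (\<lambda>x. std_normal_density x * exp (t * x)) (exp (t\<^sup>2 / 2))"
      unfolding eq by (simp add: has_bochner_integral_iff)
    then show ?thesis
      using distributed_integrable[OF D[OF that], of "\<lambda>x. exp (t * x)"]
        distributed_integral[OF D[OF that], of "\<lambda>x. exp (t * x)"]
      by (simp add: has_bochner_integral_iff)
  qed
  have Xi: "integrable M (X i)" if "i \<in> I" for i using D[OF that] by (rule std_normal_integrable)
  have "t * expectation (\<lambda>x. MAX i\<in>I. X i x) = expectation (\<lambda>x. t * (MAX i\<in>I. X i x))"
    by simp
  also have "\<dots> \<le> expectation (\<lambda>x. ln A + (\<Sum>i\<in>I. exp (t * X i x)) / A - 1)"
  proof (rule integral_mono)
    show "integrable M (\<lambda>x. t * (MAX i\<in>I. X i x))"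
      using integrable_Max_image[OF I Xi] by simp
    show "integrable M (\<lambda>x. ln A + (\<Sum>i\<in>I. exp (t * X i x)) / A - 1)"
      using mgf by (auto simp: has_bochner_integral_iff)
    fix x
    have "(MAX i\<in>I. X i x) \<in> (\<lambda>i. X i x) ` I" using I by (intro Max_in) auto
    then obtain j where j: "j \<in> I" "(MAX i\<in>I. X i x) = X j x" by auto
    have "1 + (t * X j x - ln A) \<le> exp (t * X j x - ln A)" by (rule exp_ge_add_one_self)
    also have "\<dots> = exp (t * X j x) / A" using A by (simp add: exp_diff)
    also have "\<dots> \<le> (\<Sum>i\<in>I. exp (t * X i x)) / A"
      using A I j by (intro divide_right_mono member_le_sum) auto
    finally show "t * (MAX i\<in>I. X i x) \<le> ln A + (\<Sum>i\<in>I. exp (t * X i x)) / A - 1"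
      using j by simp
  qed
  also have "\<dots> = ln A + (\<Sum>i\<in>I. exp (t\<^sup>2 / 2)) / A - 1"
    using mgf by (simp add: has_bochner_integral_iff prob_space)
  also have "\<dots> = ln n + t\<^sup>2 / 2"
    using n by (simp add: A_def n_def ln_mult)
  also have "\<dots> = t * t" using n by (simp add: t_def)
  finally have "expectation (\<lambda>x. MAX i\<in>I. X i x) \<le> t"
    using t by (simp only: mult_le_cancel_left_pos)
  then show ?thesis by (simp add: t_def n_def)
qed

section \<open>Lower bound on the expected Gaussian maximum\<close>

text \<open>
  Write \<open>A\<close> for the event that some \<open>X\<^sub>i\<close> with \<open>i \<noteq> j\<close> reaches \<open>a\<close>. Then the maximum is at least
  \<open>X\<^sub>j + max 0 (a - X\<^sub>j) 1\<^sub>A\<close>. The first term has mean \<open>0\<close>; by independence the second one has mean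
  \<open>E max 0 (a - X\<^sub>j) P(A) \<ge> a P(A)\<close>. Starting from \<open>X\<^sub>j\<close>, instead of from \<open>0\<close>, spares any estimate of
  the negative part of the maximum.
\<close>
lemma (in prob_space) expectation_Max_centered_indep_ge:
  fixes X :: "'i \<Rightarrow> 'a \<Rightarrow> real"
  assumes I: "finite I" "j \<in> I" and ind: "indep_vars (\<lambda>_. borel) X I"
    and int: "\<And>i. i \<in> I \<Longrightarrow> integrable M (X i)" and mean: "expectation (X j) = 0"
    and a: "a \<ge> 0"
  shows "a * (1 - (\<Prod>i\<in>I - {j}. \<P>(x in M. X i x < a))) \<le> expectation (\<lambda>x. MAX i\<in>I. X i x)"
proof -
  \<comment> \<open>The product of all \<open>Y i (X i)\<close> is \<open>max 0 (a - X j)\<close> times the indicator of the complement of \<open>A\<close>.\<close>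
  define Y where "Y i y = (if i = j then max 0 (a - y) else of_bool (y < a))" for i y
  have [measurable]: "X i \<in> borel_measurable M" if "i \<in> I" for i
    using int[OF that] by auto
  have intY: "integrable M (\<lambda>x. Y i (X i x))" if "i \<in> I" for i
  proof (cases "i = j")
    case False
    with that show ?thesis
      by (intro integrable_const_bound[where B=1]) (auto simp: Y_def)
  qed (use that int in \<open>auto simp: Y_def\<close>)
  have indY: "indep_vars (\<lambda>_. borel) (\<lambda>i x. Y i (X i x)) I"
    by (rule indep_vars_compose2[OF ind]) (auto simp: Y_def)
  define p where "p = expectation (\<lambda>x. Y j (X j x))"
  let ?q = "\<Prod>i\<in>I - {j}. \<P>(x in M. X i x < a)"
  have "expectation (\<lambda>x. \<Prod>i\<in>I. Y i (X i x)) = (\<Prod>i\<in>I. expectation (\<lambda>x. Y i (X i x)))"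
    by (rule indep_vars_lebesgue_integral[OF I(1) indY intY])
  also have "\<dots> = p * (\<Prod>i\<in>I - {j}. expectation (\<lambda>x. Y i (X i x)))"
    by (simp add: prod.remove[OF I] p_def)
  also have "(\<Prod>i\<in>I - {j}. expectation (\<lambda>x. Y i (X i x))) = ?q"
  proof (rule prod.cong[OF refl])
    fix i assume i: "i \<in> I - {j}"
    then have [measurable]: "X i \<in> borel_measurable M" by simp
    have "expectation (\<lambda>x. Y i (X i x)) = expectation (indicator {x\<in>space M. X i x < a})"
      by (intro Bochner_Integration.integral_cong) (use i in \<open>auto simp: Y_def indicator_def\<close>)
    then show "expectation (\<lambda>x. Y i (X i x)) = \<P>(x in M. X i x < a)" by simp
  qed
  finally have prodY: "expectation (\<lambda>x. \<Prod>i\<in>I. Y i (X i x)) = p * ?q" .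
  have "expectation (\<lambda>x. a - X j x) \<le> p"
    unfolding p_def by (intro integral_mono intY I) (use int I in \<open>auto simp: Y_def\<close>)
  then have "a \<le> p" using int I mean by (simp add: prob_space)
  moreover have "?q \<le> 1" by (intro prod_le_1) auto
  ultimately have "a * (1 - ?q) \<le> p * (1 - ?q)" by (intro mult_right_mono) auto
  also have "\<dots> = expectation (\<lambda>x. X j x + Y j (X j x) - (\<Prod>i\<in>I. Y i (X i x)))"
    using int intY I mean prodY indep_vars_integrable[OF I(1) indY intY]
    by (simp add: p_def algebra_simps)
  also have "\<dots> \<le> expectation (\<lambda>x. MAX i\<in>I. X i x)"
  proof (rule integral_mono)
    show "integrable M (\<lambda>x. X j x + Y j (X j x) - (\<Prod>i\<in>I. Y i (X i x)))"
      using int intY I indep_vars_integrable[OF I(1) indY intY] by auto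
    show "integrable M (\<lambda>x. MAX i\<in>I. X i x)"
      by (rule integrable_Max_image) (use int I in auto)
    fix x
    have ge: "X i x \<le> (MAX i\<in>I. X i x)" if "i \<in> I" for i
      using I that by (intro Max_ge) auto
    show "X j x + Y j (X j x) - (\<Prod>i\<in>I. Y i (X i x)) \<le> (MAX i\<in>I. X i x)"
    proof (cases "\<exists>i\<in>I - {j}. X i x \<ge> a")
      case True
      then obtain i where i: "i \<in> I - {j}" "X i x \<ge> a" by auto
      then have "(\<Prod>i\<in>I. Y i (X i x)) = 0"
        using I by (intro prod_zero) (auto intro!: bexI[of _ i] simp: Y_def)
      moreover have "X j x + Y j (X j x) = max (X j x) a" by (simp add: Y_def max_def)
      moreover have "max (X j x) a \<le> (MAX i\<in>I. X i x)"
        by (rule max.boundedI[OF ge[OF I(2)] order_trans[OF i(2) ge]]) (use i in simp)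
      ultimately show ?thesis by simp
    next
      case False
      then have "(\<Prod>i\<in>I - {j}. Y i (X i x)) = (\<Prod>i\<in>I - {j}. 1)"
        by (intro prod.cong) (auto simp: Y_def not_le)
      then have "(\<Prod>i\<in>I. Y i (X i x)) = Y j (X j x)"
        by (simp add: prod.remove[OF I])
      then show ?thesis using ge[of j] I by simp
    qed
  qed
  finally show ?thesis .
qed

text \<open>
  Twice the maximum is \<open>X + Y + \<bar>X - Y\<bar>\<close>, and \<open>X - Y\<close> is Gaussian with variance \<open>2\<close>.
\<close>
lemma (in prob_space) expectation_max_two_std_normal:
  assumes ind: "indep_var borel X borel Y"
    and X: "distributed M lborel X std_normal_density" and Y: "distributed M lborel Y std_normal_density"
  shows "expectation (\<lambda>x. max (X x) (Y x)) = 1 / sqrt pi"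
proof -
  have D: "distributed M lborel (\<lambda>x. X x - Y x) (normal_density 0 (sqrt 2))"
    using diff_indep_normal[OF ind _ _ X Y] by simp
  have "expectation (\<lambda>x. \<bar>X x - Y x\<bar>) = sqrt 2 * sqrt (2 / pi)"
    using distributed_integral[OF D, of abs] integral_normal_moment_abs_odd[of "sqrt 2" 0 0] by simp
  moreover have "integrable M (\<lambda>x. \<bar>X x - Y x\<bar>)"
    using X Y by (intro integrable_abs Bochner_Integration.integrable_diff std_normal_integrable)
  moreover have "expectation (\<lambda>x. max (X x) (Y x)) = expectation (\<lambda>x. (X x + Y x + \<bar>X x - Y x\<bar>) / 2)"
    by (intro Bochner_Integration.integral_cong) auto
  ultimately show ?thesis
    using std_normal_integrable[OF X] std_normal_integrable[OF Y]
      standard_normal_distributed_expectation[OF X] standard_normal_distributed_expectation[OF Y]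
    by (simp add: real_sqrt_divide)
qed

text \<open>
  At \<open>a = \<surd>(ln n) / 2\<close> the tail bound reads \<open>1 - \<Phi>(a) \<ge> q\<close> with \<open>q\<close> of order \<open>n powr (-1/4)\<close>. So
  \<open>(n - 1) q\<close> grows like \<open>n powr (3/4)\<close>; it exceeds \<open>1.4\<close> from \<open>n = 8\<close> on, and \<open>exp(-1.4) < 0.3\<close>.
\<close>
lemma gaussian_threshold_product_bound:
  fixes n :: nat
  assumes n: "n \<ge> 8"
  defines "a \<equiv> sqrt (ln n) / 2"
  shows "std_normal_cdf a ^ (n - 1) \<le> 0.3"
proof -
  define r where "r = exp (ln n / 4)"
  define q where "q = exp (- a\<^sup>2) / (2 * sqrt 2)"
  \<comment> \<open>The constants follow from \<open>1.66 ^ 4 \<le> 8\<close> and \<open>7/8 \<cdot> 1.66 ^ 3 \<ge> 1.4 \<cdot> 2 \<surd>2\<close>.\<close>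
  have r4: "r ^ 4 = n"
    using n by (simp add: r_def exp_of_nat_mult[symmetric])
  have "1.66 ^ 4 \<le> r ^ 4" unfolding r4 using n by (simp add: power4_eq_xxxx)
  then have "1.66 \<le> r" by (rule power_le_imp_le_base[of _ 3, simplified]) (simp add: r_def)
  then have r3: "1.66 ^ 3 \<le> r ^ 3" by (intro power_mono) auto
  have s2: "sqrt 2 \<le> 1.415" by (rule real_le_lsqrt) (auto simp: power2_eq_square)
  have "a\<^sup>2 = ln n / 4" using n by (simp add: a_def power_divide)
  then have q: "q = 1 / (2 * sqrt 2 * r)" by (simp add: q_def r_def exp_minus field_simps)
  have "1.4 * (2 * sqrt 2) \<le> 7 / 8 * r ^ 3"
    using s2 r3 by (simp add: power3_eq_cube)
  then have "1.4 \<le> 7 / 8 * r ^ 3 / (2 * sqrt 2)" by (simp add: field_simps)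
  also have "\<dots> = 7 / 8 * n * q"
    unfolding q r4[symmetric] using \<open>1.66 \<le> r\<close> by (simp add: field_simps power4_eq_xxxx power3_eq_cube)
  also have "\<dots> \<le> real (n - 1) * q"
    using n by (intro mult_right_mono) (auto simp: q_def of_nat_diff)
  finally have nq: "1.4 \<le> real (n - 1) * q" .
  have "std_normal_cdf a \<le> 1 - q"
    using std_normal_upper_tail_ge[of a] by (simp add: q_def)
  also have "\<dots> \<le> exp (- q)"
    using exp_ge_add_one_self[of "- q"] by simp
  finally have "std_normal_cdf a ^ (n - 1) \<le> exp (- q) ^ (n - 1)"
    using std_normal_cdf_pos[of a] by (intro power_mono) auto
  also have "\<dots> = exp (- (real (n - 1) * q))"
    by (simp add: exp_of_nat_mult[symmetric])
  also have "\<dots> \<le> exp (- 1.4)" unfolding exp_le_cancel_iff using nq by linarith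
  also have "\<dots> \<le> 0.3"
    using exp_lower_Taylor_quadratic[of "1.4"] by (simp add: exp_minus field_simps power2_eq_square)
  finally show ?thesis .
qed

text \<open>
  The constant is far from the asymptotically sharp \<open>\<surd>2\<close>: it only has to satisfy
  \<open>0.34 \<surd>2 \<ge> 0.478\<close>. For \<open>n \<ge> 8\<close> the threshold argument gives \<open>0.7 / 2\<close>. For the
  smallest \<open>n\<close> it is too weak, but up to \<open>n = 8\<close> the bound \<open>0.34 \<surd>(ln 8) \<le> 1/2 \<le> 1/\<surd>\<pi>\<close> makes two
  of the variables suffice.
\<close>
theorem (in prob_space) expectation_Max_std_normal_ge:
  fixes X :: "'i \<Rightarrow> 'a \<Rightarrow> real"
  assumes I: "finite I" "I \<noteq> {}" and ind: "indep_vars (\<lambda>_. borel) X I"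
    and D: "\<And>i. i \<in> I \<Longrightarrow> distributed M lborel (X i) std_normal_density"
  shows "0.34 * sqrt (ln (card I)) \<le> expectation (\<lambda>x. MAX i\<in>I. X i x)"
proof -
  define n where "n = card I"
  obtain j where j: "j \<in> I" using I by auto
  have int: "integrable M (X i)" if "i \<in> I" for i using D[OF that] by (rule std_normal_integrable)
  have mean: "expectation (X i) = 0" if "i \<in> I" for i
    using D[OF that] by (rule standard_normal_distributed_expectation)
  have "n > 0" using I by (simp add: n_def card_gt_0_iff)
  then consider "n = 1" | "2 \<le> n" "n \<le> 8" | "n \<ge> 8" by linarith
  then show ?thesis
  proof cases
    case 1
    then obtain i where "I = {i}" unfolding n_def by (rule card_1_singletonE)
    then show ?thesis using mean[of i] by simp
  next
    case 2
    have "card (I - {j}) > 0" using 2 j by (simp add: n_def)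
    then have "I - {j} \<noteq> {}" by (auto simp only: card.empty)
    then obtain i where i: "i \<in> I" "i \<noteq> j" by auto
    have "indep_var borel (X i) borel (\<lambda>x. \<Sum>k\<in>{j}. X k x)"
      by (rule indep_vars_sum) (use i j indep_vars_subset[OF ind] in auto)
    then have "expectation (\<lambda>x. max (X i x) (X j x)) = 1 / sqrt pi"
      using D i j by (intro expectation_max_two_std_normal) auto
    moreover have "expectation (\<lambda>x. max (X i x) (X j x)) \<le> expectation (\<lambda>x. MAX i\<in>I. X i x)"
      using i j I int by (intro integral_mono integrable_max integrable_Max_image) auto
    moreover have "1 / 2 \<le> 1 / sqrt pi"
      using pi_less_4 pi_gt_zero by (intro divide_left_mono) (auto intro: real_le_lsqrt)
    moreover have "0.34 * sqrt (ln n) \<le> 1 / 2"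
    proof -
      have "ln (real n) \<le> ln (2 ^ 3)" using 2 by simp
      also have "\<dots> = 3 * ln 2" by (subst ln_realpow) auto
      also have "\<dots> \<le> 2.1" using ln2_le_25_over_36 by simp
      finally have "sqrt (ln n) \<le> 1.45"
        by (intro real_le_lsqrt) (auto simp: power2_eq_square)
      then show ?thesis by simp
    qed
    ultimately show ?thesis unfolding n_def by linarith
  next
    case 3
    define a where "a = sqrt (ln n) / 2"
    have "(\<Prod>i\<in>I - {j}. \<P>(x in M. X i x < a)) = (\<Prod>i\<in>I - {j}. std_normal_cdf a)"
      by (intro prod.cong refl std_normal_prob_le(2) D) auto
    also have "\<dots> = std_normal_cdf a ^ (n - 1)" using I j by (simp add: n_def)
    also have "\<dots> \<le> 0.3" unfolding a_def by (rule gaussian_threshold_product_bound[OF 3])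
    finally have "a * 0.7 \<le> a * (1 - (\<Prod>i\<in>I - {j}. \<P>(x in M. X i x < a)))"
      using 3 by (intro mult_left_mono) (auto simp: a_def)
    also have "\<dots> \<le> expectation (\<lambda>x. MAX i\<in>I. X i x)"
      using 3 by (intro expectation_Max_centered_indep_ge I j ind int mean) (auto simp: a_def)
    finally have "0.35 * sqrt (ln n) \<le> expectation (\<lambda>x. MAX i\<in>I. X i x)"
      by (simp add: a_def)
    moreover have "0.34 * sqrt (ln n) \<le> 0.35 * sqrt (ln n)"
      using 3 by (intro mult_right_mono) auto
    ultimately show ?thesis unfolding n_def by linarith
  qed
qed

section \<open>The largest energy error\<close>

theorem (in prob_space)
  fixes X :: "'i \<Rightarrow> 'a \<Rightarrow> real"
  assumes I: "finite I" "I \<noteq> {}" and \<sigma>: "\<sigma> > 0" and ind: "indep_vars (\<lambda>_. borel) X I"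
    and D: "\<And>i. i \<in> I \<Longrightarrow> distributed M lborel (X i) (normal_density 0 \<sigma>)"
  shows expectation_Max_normal_ge: "0.34 * \<sigma> * sqrt (ln (card I)) \<le> expectation (\<lambda>x. MAX i\<in>I. X i x)"
    and expectation_Max_normal_le: "expectation (\<lambda>x. MAX i\<in>I. X i x) \<le> \<sigma> * sqrt (2 * ln (card I))"
    and variance_Max_normal_le: "variance (\<lambda>x. MAX i\<in>I. X i x) \<le> \<sigma>\<^sup>2"
proof -
  define Z where "Z i x = X i x / \<sigma>" for i x
  have Z: "distributed M lborel (Z i) std_normal_density" if "i \<in> I" for i
    using D[OF that] normal_standard_normal_convert[OF \<sigma>, of "X i" 0] by (simp add: Z_def[abs_def])
  have indZ: "indep_vars (\<lambda>_. borel) Z I"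
    unfolding Z_def[abs_def] by (rule indep_vars_compose2[OF ind]) auto
  have "\<sigma> * (MAX i\<in>I. Z i x) = Max ((*) \<sigma> ` (\<lambda>i. Z i x) ` I)" for x
    using \<sigma> I by (intro mono_Max_commute) (auto intro!: monoI)
  then have Max: "(MAX i\<in>I. X i x) = \<sigma> * (MAX i\<in>I. Z i x)" for x
    using \<sigma> by (simp add: image_image Z_def)
  have bounds: "0.34 * sqrt (ln (card I)) \<le> expectation (\<lambda>x. MAX i\<in>I. Z i x)"
    "expectation (\<lambda>x. MAX i\<in>I. Z i x) \<le> sqrt (2 * ln (card I))"
    "variance (\<lambda>x. MAX i\<in>I. Z i x) \<le> 1"
    by (intro expectation_Max_std_normal_ge expectation_Max_std_normal_le
        variance_Max_std_normal_le_1 I indZ Z; assumption)+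
  show "0.34 * \<sigma> * sqrt (ln (card I)) \<le> expectation (\<lambda>x. MAX i\<in>I. X i x)"
    unfolding Max using mult_left_mono[OF bounds(1), of \<sigma>] \<sigma> by (simp add: ac_simps)
  show "expectation (\<lambda>x. MAX i\<in>I. X i x) \<le> \<sigma> * sqrt (2 * ln (card I))"
    unfolding Max using mult_left_mono[OF bounds(2), of \<sigma>] \<sigma> by simp
  have "variance (\<lambda>x. \<sigma> * (MAX i\<in>I. Z i x)) = \<sigma>\<^sup>2 * variance (\<lambda>x. MAX i\<in>I. Z i x)"
    by (simp add: right_diff_distrib[symmetric] power_mult_distrib)
  then show "variance (\<lambda>x. MAX i\<in>I. X i x) \<le> \<sigma>\<^sup>2"
    unfolding Max using mult_left_mono[OF bounds(3), of "\<sigma>\<^sup>2"] by simp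
qed

theorem theorem2:
  fixes M :: "'a measure" and M' :: "'b measure"
    and w :: "nat \<Rightarrow> nat \<Rightarrow> 'a \<Rightarrow> real" and G :: "nat \<Rightarrow> 'b \<Rightarrow> real"
    and N K :: nat and b \<epsilon> \<Delta>t :: real
  assumes "N \<ge> 1" and "K \<ge> 1" and "b > 0" and "\<epsilon> > 0" and "\<Delta>t > 0"
    and "prob_space M"
    and "prob_space.indep_vars M (\<lambda>_. borel) (\<lambda>(i, k). w i k) ({1..N} \<times> {1..K})"
    and "\<And>i k. i \<in> {1..N} \<Longrightarrow> k \<in> {1..K} \<Longrightarrow>
           distributed M lborel (w i k) (laplace_density (b / \<epsilon>))"
    and "gaussian_approximation M (energy_error \<Delta>t K w) M' G {1..N}"
  shows "0.478 * (b / \<epsilon>) * \<Delta>t * sqrt (real K) * sqrt (ln (real N))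
           \<le> prob_space.expectation M' (\<lambda>x. MAX i\<in>{1..N}. G i x)
       \<and> prob_space.expectation M' (\<lambda>x. MAX i\<in>{1..N}. G i x)
           \<le> 2 * (b / \<epsilon>) * \<Delta>t * sqrt (real K) * sqrt (ln (real N))
       \<and> prob_space.variance M' (\<lambda>x. MAX i\<in>{1..N}. G i x)
           \<le> 8 * real K * (b\<^sup>2 / \<epsilon>\<^sup>2) * \<Delta>t\<^sup>2"
proof -
  define c where "c = b / \<epsilon>"
  \<comment> \<open>The bounds are stated in units of \<open>s = \<sigma> / \<surd>2\<close>.\<close>
  define s where "s = c * \<Delta>t * sqrt K"
  define \<sigma> where "\<sigma> = sqrt 2 * s"
  have c: "c > 0" using assms by (simp add: c_def)
  have s: "s > 0" using assms c by (simp add: s_def)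
  have \<sigma>: "\<sigma> > 0" using s by (simp add: \<sigma>_def)
  have \<sigma>2: "\<sigma>\<^sup>2 = 2 * real K * c\<^sup>2 * \<Delta>t\<^sup>2"
    by (simp add: \<sigma>_def s_def power_mult_distrib)
  interpret M': prob_space M'
    using assms(9) by (simp add: gaussian_approximation_def)
  have G: "distributed M' lborel (G i) (normal_density 0 \<sigma>)" if i: "i \<in> {1..N}" for i
  proof -
    note E = prob_space.expectation_energy_error[OF assms(6) c assms(7) i assms(8)[OF i, folded c_def]]
    note V = prob_space.variance_energy_error[OF assms(6) c assms(7) i assms(8)[OF i, folded c_def]]
    have "sqrt (2 * real K * c\<^sup>2 * \<Delta>t\<^sup>2) = \<sigma>" using \<sigma> by (simp flip: \<sigma>2)
    with E V show ?thesis
      using assms(9) i unfolding gaussian_approximation_def by metis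
  qed
  have I: "finite {1..N}" "{1..N} \<noteq> {}" using assms(1) by auto
  have ind: "M'.indep_vars (\<lambda>_. borel) G {1..N}"
    using assms(9) by (simp add: gaussian_approximation_def)
  have "0.478 / 0.34 \<le> sqrt 2" by (rule real_le_rsqrt) (simp add: power2_eq_square)
  then have "0.478 * s \<le> 0.34 * \<sigma>" using s by (simp add: \<sigma>_def)
  then have "0.478 * s * sqrt (ln N) \<le> 0.34 * \<sigma> * sqrt (ln N)"
    using assms(1) by (intro mult_right_mono) auto
  also have "\<dots> \<le> M'.expectation (\<lambda>x. MAX i\<in>{1..N}. G i x)"
    using M'.expectation_Max_normal_ge[OF I \<sigma> ind G] by simp
  finally have lower: "0.478 * s * sqrt (ln N) \<le> M'.expectation (\<lambda>x. MAX i\<in>{1..N}. G i x)" .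
  have "M'.expectation (\<lambda>x. MAX i\<in>{1..N}. G i x) \<le> \<sigma> * sqrt (2 * ln N)"
    using M'.expectation_Max_normal_le[OF I \<sigma> ind G] by simp
  also have "\<dots> = 2 * s * sqrt (ln N)"
    by (simp add: \<sigma>_def real_sqrt_mult)
  finally have upper: "M'.expectation (\<lambda>x. MAX i\<in>{1..N}. G i x) \<le> 2 * s * sqrt (ln N)" .
  have "M'.variance (\<lambda>x. MAX i\<in>{1..N}. G i x) \<le> \<sigma>\<^sup>2"
    using M'.variance_Max_normal_le[OF I \<sigma> ind G] by simp
  also have "\<sigma>\<^sup>2 \<le> 8 * real K * c\<^sup>2 * \<Delta>t\<^sup>2"
    unfolding \<sigma>2 by (intro mult_right_mono) auto
  finally have "M'.variance (\<lambda>x. MAX i\<in>{1..N}. G i x) \<le> 8 * real K * (b\<^sup>2 / \<epsilon>\<^sup>2) * \<Delta>t\<^sup>2"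
    by (simp add: c_def power_divide)
  with lower upper show ?thesis
    unfolding s_def c_def by (simp only: mult.assoc)
qed

end
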